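(* Let $Q\in\mathbb{R}^{n\times n}$ be symmetric, $b\in\mathbb{R}^n$, and let $\bar p=(Q_{11},Q_{22},\dots,Q_{nn})^T$. Let $p\in\mathbb{R}^n$ satisfy $p>\bar p$ (componentwise, i.e. $p_i>Q_{ii}$ for all $i$). Consider the two problems $$\text{(O)}\quad \min_{x\in F} f(x),\qquad\qquad \text{(P)}\quad \min_{x\in G} h(x,p).$$ Then: (i) if $\bar x$ is an optimal point of (O), then $\bar x$ is a global optimal point of (P); (ii) if $x^\star$ is a global optimal point of (P), then $x^\star$ is an optimal point of (O).
   Context: Notation: $f(x)=x^TQx+b^Tx$ for $x\in\mathbb{R}^n$; $F=\{0,1\}^n$; $G=\{x\in\mathbb{R}^n: 0\le x_i\le 1,\ i=1,\dots,n\}$; and for $p\in\mathbb{R}^n$, $h(x,p)=f(x)+\sum_{i=1}^n p_i(x_i-x_i^2)$. Problem (O) is the unconstrained binary quadratic program and (P) is its penalty problem with penalty vector $p$. *)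

theory Defs
  imports "HOL-Analysis.Analysis"
begin

definition quad_fun :: "real ^ 'n ^ 'n \<Rightarrow> real ^ 'n \<Rightarrow> real ^ 'n \<Rightarrow> real" where
  "quad_fun Q b x = x \<bullet> (Q *v x) + b \<bullet> x"

definition penalty_fun ::
  "real ^ 'n ^ 'n \<Rightarrow> real ^ 'n \<Rightarrow> real ^ 'n \<Rightarrow> real ^ 'n \<Rightarrow> real" where
  "penalty_fun Q b x p = quad_fun Q b x + (\<Sum>i\<in>UNIV. p $ i * (x $ i - (x $ i)\<^sup>2))"

definition binary_points :: "(real ^ 'n) set" where
  "binary_points = {x. \<forall>i. x $ i \<in> {0, 1}}"

definition unit_cube :: "(real ^ 'n) set" where
  "unit_cube = {x. \<forall>i. 0 \<le> x $ i \<and> x $ i \<le> 1}"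

definition diag_vec :: "real ^ 'n ^ 'n \<Rightarrow> real ^ 'n" where
  "diag_vec Q = (\<chi> i. Q $ i $ i)"

end

theory Submission
  imports Defs
begin

text \<open>
  The penalty term vanishes on binary points, so there the penalty function agrees with the
  quadratic objective. Restricted to a line parallel to the \<open>i\<close>-th axis, the penalty function is a
  quadratic polynomial with leading coefficient \<open>Q\<^sub>i\<^sub>i - p\<^sub>i < 0\<close>, hence strictly concave. A strictly
  concave function on a segment is larger in the interior than at one of the ends, so any fractional
  coordinate of a point of the cube can be rounded to \<open>0\<close> or \<open>1\<close> with a strict decrease of the
  penalty function (\<open>penalty_fun_round_coordinate\<close>). Rounding the fractional coordinates one after
  another leads to a binary point (\<open>penalty_fun_round\<close>). Consequently the minimum of the penalty
  function over the cube is its minimum over the binary points, and no point with a fractional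
  coordinate attains it; both claims follow.
\<close>

lemma penalty_fun_binary:
  assumes "x \<in> binary_points"
  shows "penalty_fun Q b x p = quad_fun Q b x"
proof -
  have "p $ i * (x $ i - (x $ i)\<^sup>2) = 0" for i
    using assms by (auto simp: binary_points_def dest!: spec[of _ i])
  then have "(\<Sum>i\<in>UNIV. p $ i * (x $ i - (x $ i)\<^sup>2)) = 0"
    by (intro sum.neutral) blast
  then show ?thesis
    by (simp add: penalty_fun_def)
qed

lemma binary_points_subset_unit_cube: "binary_points \<subseteq> unit_cube"
proof
  fix x :: "real ^ 'n"
  assume "x \<in> binary_points"
  then have "x $ i = 0 \<or> x $ i = 1" for i
    by (simp add: binary_points_def)
  then have "0 \<le> x $ i \<and> x $ i \<le> 1" for i
    by (metis order_refl zero_le_one)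
  then show "x \<in> unit_cube"
    by (simp add: unit_cube_def)
qed

text \<open>
  Only the leading coefficient of the restriction to a line matters for concavity, so the linear
  coefficient is left existential; what counts is that it is the same for all \<open>t\<close>.
\<close>

lemma penalty_fun_along_axis:
  fixes Q :: "real ^ 'n ^ 'n"
  shows "\<exists>D. \<forall>t. penalty_fun Q b (x + t *\<^sub>R axis i 1) p
                  = penalty_fun Q b x p + D * t + (Q $ i $ i - p $ i) * t\<^sup>2"
proof -
  let ?e = "axis i 1 :: real ^ 'n"
  define D1 where "D1 = ?e \<bullet> (Q *v x) + x \<bullet> (Q *v ?e) + b \<bullet> ?e"
  have "?e \<bullet> (Q *v ?e) = Q $ i $ i"
    by (simp add: inner_axis' matrix_vector_mul_component inner_axis)
  then have quad: "quad_fun Q b (x + t *\<^sub>R ?e) = quad_fun Q b x + D1 * t + Q $ i $ i * t\<^sup>2" for t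
    by (simp add: quad_fun_def D1_def matrix_vector_right_distrib matrix_vector_mult_scaleR
        inner_add_left inner_add_right algebra_simps power2_eq_square)
  define g where "g y = (\<lambda>j. p $ j * (y $ j - (y $ j)\<^sup>2))" for y :: "real ^ 'n"
  have pen: "sum (g (x + t *\<^sub>R ?e)) UNIV
      = sum (g x) UNIV + p $ i * (1 - 2 * x $ i) * t - p $ i * t\<^sup>2" for t
  proof -
    have "sum (g (x + t *\<^sub>R ?e)) (UNIV - {i}) = sum (g x) (UNIV - {i})"
      by (intro sum.cong) (auto simp: g_def axis_def)
    moreover have "g (x + t *\<^sub>R ?e) i = g x i + p $ i * (1 - 2 * x $ i) * t - p $ i * t\<^sup>2"
      by (simp add: g_def axis_def algebra_simps power2_eq_square)
    ultimately show ?thesis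
      by (simp add: sum.remove[of UNIV i])
  qed
  have "penalty_fun Q b (x + t *\<^sub>R ?e) p
      = penalty_fun Q b x p + (D1 + p $ i * (1 - 2 * x $ i)) * t + (Q $ i $ i - p $ i) * t\<^sup>2" for t
    using quad[of t] pen[of t] unfolding penalty_fun_def g_def
    by (simp add: algebra_simps)
  then show ?thesis
    by blast
qed

text \<open>
  Strict concavity along the axis: with \<open>a = x\<^sub>i\<close>, the point \<open>x\<close> divides the segment between its two
  roundings with weights \<open>1 - a\<close> and \<open>a\<close>, and the weighted mean of the end values falls short of the
  value at \<open>x\<close> by \<open>(p\<^sub>i - Q\<^sub>i\<^sub>i) a (1 - a) > 0\<close>.
\<close>

lemma penalty_fun_round_coordinate:
  fixes Q :: "real ^ 'n ^ 'n"
  assumes conc: "Q $ i $ i < p $ i" and a: "0 < x $ i" "x $ i < 1"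
  shows "\<exists>c\<in>{0, 1}. penalty_fun Q b (x + (c - x $ i) *\<^sub>R axis i 1) p < penalty_fun Q b x p"
proof (rule ccontr)
  define a where "a = x $ i"
  obtain D where D: "penalty_fun Q b (x + t *\<^sub>R axis i 1) p
      = penalty_fun Q b x p + D * t + (Q $ i $ i - p $ i) * t\<^sup>2" for t
    using penalty_fun_along_axis[of Q b x i p] by blast
  define q where "q t = D * t + (Q $ i $ i - p $ i) * t\<^sup>2" for t
  assume "\<not> ?thesis"
  then have "0 \<le> q (0 - a)" "0 \<le> q (1 - a)"
    by (auto simp: D q_def a_def not_less)
  then have "0 \<le> (1 - a) * q (0 - a) + a * q (1 - a)"
    using a by (simp add: a_def)
  also have "\<dots> = - ((p $ i - Q $ i $ i) * (a * (1 - a)))"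
    by (simp add: q_def algebra_simps power2_eq_square)
  also have "\<dots> < 0"
    using conc a by (simp add: a_def)
  finally show False
    by simp
qed

text \<open>
  The induction is on the number of fractional coordinates, which each rounding step lowers.
\<close>

lemma penalty_fun_round:
  fixes Q :: "real ^ 'n ^ 'n"
  assumes conc: "\<And>i. Q $ i $ i < p $ i"
    and "x \<in> unit_cube" and "x \<notin> binary_points"
  shows "\<exists>y\<in>binary_points. penalty_fun Q b y p < penalty_fun Q b x p"
  using assms(2,3)
proof (induction "card {i. x $ i \<notin> {0, 1}}" arbitrary: x rule: less_induct)
  case less
  obtain i where i: "x $ i \<notin> {0, 1}"
    using less.prems(2) by (auto simp: binary_points_def)
  then have "0 < x $ i" "x $ i < 1"
    using less.prems(1) by (auto simp: unit_cube_def less_le)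
  then obtain c where c: "c \<in> {0, 1}"
    and dec: "penalty_fun Q b (x + (c - x $ i) *\<^sub>R axis i 1) p < penalty_fun Q b x p"
    using penalty_fun_round_coordinate[OF conc] by blast
  define z where "z = x + (c - x $ i) *\<^sub>R axis i 1"
  have z: "z $ j = (if j = i then c else x $ j)" for j
    by (simp add: z_def axis_def)
  have cube: "z \<in> unit_cube"
    using less.prems(1) c by (auto simp: unit_cube_def z)
  have "{j. z $ j \<notin> {0, 1}} \<subset> {j. x $ j \<notin> {0, 1}}"
    using c i by (auto simp: z)
  then have "card {j. z $ j \<notin> {0, 1}} < card {j. x $ j \<notin> {0, 1}}"
    by (intro psubset_card_mono) simp_all
  then have "z \<in> binary_points \<or> (\<exists>y\<in>binary_points. penalty_fun Q b y p < penalty_fun Q b z p)"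
    using less.hyps cube by blast
  then show ?case
    using dec unfolding z_def[symmetric] by (meson less_trans)
qed

theorem theorem4p1:
  fixes Q :: "real ^ 'n ^ 'n" and b p :: "real ^ 'n"
  assumes "transpose Q = Q"
    and "\<forall>i. p $ i > diag_vec Q $ i"
  shows "(\<forall>xbar. is_arg_min (quad_fun Q b) (\<lambda>x. x \<in> binary_points) xbar \<longrightarrow>
            is_arg_min (\<lambda>x. penalty_fun Q b x p) (\<lambda>x. x \<in> unit_cube) xbar) \<and>
         (\<forall>xstar. is_arg_min (\<lambda>x. penalty_fun Q b x p) (\<lambda>x. x \<in> unit_cube) xstar \<longrightarrow>
            is_arg_min (quad_fun Q b) (\<lambda>x. x \<in> binary_points) xstar)"
proof (intro conjI allI impI)
  have "Q $ i $ i < p $ i" for i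
    using assms(2) by (simp add: diag_vec_def)
  note round = penalty_fun_round[OF this, where b = b]
  note sub = subsetD[OF binary_points_subset_unit_cube]
  {
    fix xbar
    assume "is_arg_min (quad_fun Q b) (\<lambda>x. x \<in> binary_points) xbar"
    then have bin: "xbar \<in> binary_points"
      and opt: "\<And>y. y \<in> binary_points \<Longrightarrow> penalty_fun Q b xbar p \<le> penalty_fun Q b y p"
      by (auto simp: is_arg_min_linorder penalty_fun_binary)
    have "penalty_fun Q b xbar p \<le> penalty_fun Q b x p" if "x \<in> unit_cube" for x
      using opt round[OF that] by (meson less_imp_le order_trans)
    then show "is_arg_min (\<lambda>x. penalty_fun Q b x p) (\<lambda>x. x \<in> unit_cube) xbar"
      using sub[OF bin] by (simp add: is_arg_min_linorder)
  next
    fix xstar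
    assume "is_arg_min (\<lambda>x. penalty_fun Q b x p) (\<lambda>x. x \<in> unit_cube) xstar"
    then have cube: "xstar \<in> unit_cube"
      and opt: "\<And>y. y \<in> unit_cube \<Longrightarrow> penalty_fun Q b xstar p \<le> penalty_fun Q b y p"
      by (auto simp: is_arg_min_linorder)
    have bin: "xstar \<in> binary_points"
      using round[OF cube] opt sub by (meson not_less)
    have "quad_fun Q b xstar \<le> quad_fun Q b y" if "y \<in> binary_points" for y
      using opt[OF sub[OF that]] bin that by (simp add: penalty_fun_binary)
    then show "is_arg_min (quad_fun Q b) (\<lambda>x. x \<in> binary_points) xstar"
      using bin by (simp add: is_arg_min_linorder)
  }
qed

end
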